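(* Let $S=k[x_1,\ldots,x_n]$ be a polynomial ring over a field $k$, let $q\geq 2$, and let $I\subset S$, $I\neq I_{n,q}$, be the final squarefree lexsegment ideal generated in degree $q$ determined by the monomial $u=x_1x_{i_2}\cdots x_{i_q}$, $2\leq i_2<\cdots<i_q\leq n$. Let $F=\{i_2,\ldots,i_q\}$. Then $I$ has the minimal primary decomposition $$I=\left(\bigcap_{G\in\mathcal A}P_G\right)\cap\left(\bigcap_{G\in\mathcal B}P_G\right)\cap\left(\bigcap_{G\in\mathcal C}P_G\right),$$ where $\mathcal A=\{G\subset[n]: |G|=n-q+1,\ x_G\geq_{lex}x_{F^c}\}$, $\mathcal B=\{G\subset[n]\setminus\{1\}: |G|=n-q+1,\ x_{G\setminus\{\min(G)\}}\geq_{lex}x_{F^c\setminus\{1\}}\}$, $\mathcal C=\{G\subset[n]: |G|=n-q,\ x_{F^c\setminus\{1\}}>_{lex}x_G\}$.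
   Context: Monomials are ordered by the lexicographic order with $x_1>x_2>\cdots>x_n$. $\mathrm{Mon}^s_q(S)$ is the set of squarefree monomials of degree $q$ in $S$; $I_{n,q}$ is the ideal generated by all of $\mathrm{Mon}^s_q(S)$. For $u\in\mathrm{Mon}^s_q(S)$ put $L^f(u)=\{w\in\mathrm{Mon}^s_q(S): u\geq_{lex}w\}$; the final squarefree lexsegment ideal generated in degree $q$ determined by $u$ is $(L^f(u))$. $[n]=\{1,\ldots,n\}$. For $G\subset[n]$: $x_G=\prod_{i\in G}x_i$, $P_G=(x_i:i\in G)$, $G^c=[n]\setminus G$. "Minimal primary decomposition" means an irredundant primary decomposition: the listed ideals are exactly the distinct minimal primes of $I$. *)

theory Defs
  imports "HOL-Library.Poly_Mapping" "HOL-Algebra.Ideal"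
begin

text \<open>
  The ring \<open>k[x\<^sub>1, \<dots>, x\<^sub>n]\<close>: an exponent vector is a finitely supported function
  \<open>nat \<Rightarrow>\<^sub>0 nat\<close>, a polynomial a finitely supported function from exponent vectors to \<open>k\<close>
  (with the convolution product of \<open>Poly_Mapping\<close>), and only the variables with index in
  \<open>{1..n}\<close> may occur.
\<close>

definition polyring :: "nat \<Rightarrow> ((nat \<Rightarrow>\<^sub>0 nat) \<Rightarrow>\<^sub>0 'k::field) ring" where
  "polyring n =
     \<lparr>carrier = {p. \<forall>m \<in> Poly_Mapping.keys p. Poly_Mapping.keys m \<subseteq> {1..n}},
      monoid.mult = (*), one = 1, zero = 0, add = (+)\<rparr>"

lemma cring_polyring: "cring (polyring n :: ((nat \<Rightarrow>\<^sub>0 nat) \<Rightarrow>\<^sub>0 'k::field) ring)"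
proof -
  let ?C = "carrier (polyring n) :: ((nat \<Rightarrow>\<^sub>0 nat) \<Rightarrow>\<^sub>0 'k) set"
  have add: "p + q \<in> ?C" if "p \<in> ?C" "q \<in> ?C" for p q
    using that Poly_Mapping.keys_add[of p q] unfolding polyring_def by auto
  have uminus: "- p \<in> ?C" if "p \<in> ?C" for p
    using that by (simp add: polyring_def)
  have mult: "p * q \<in> ?C" if p: "p \<in> ?C" and q: "q \<in> ?C" for p q
  proof -
    have "Poly_Mapping.keys m \<subseteq> {1..n}" if m: "m \<in> Poly_Mapping.keys (p * q)" for m
    proof -
      obtain a b where ab: "m = a + b" "a \<in> Poly_Mapping.keys p" "b \<in> Poly_Mapping.keys q"
        using m keys_mult[of p q] by blast
      then have "Poly_Mapping.keys a \<subseteq> {1..n}" "Poly_Mapping.keys b \<subseteq> {1..n}"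
        using p q by (auto simp: polyring_def)
      then show ?thesis
        using ab(1) Poly_Mapping.keys_add[of a b] by blast
    qed
    then show ?thesis by (simp add: polyring_def)
  qed
  have one: "1 \<in> ?C" and zero: "0 \<in> ?C"
    by (simp_all add: polyring_def)
  have ring_simps: "x \<otimes>\<^bsub>polyring n\<^esub> y = x * y" "x \<oplus>\<^bsub>polyring n\<^esub> y = x + y"
    "\<one>\<^bsub>polyring n\<^esub> = 1" "\<zero>\<^bsub>polyring n\<^esub> = 0" for x y :: "(nat \<Rightarrow>\<^sub>0 nat) \<Rightarrow>\<^sub>0 'k"
    by (simp_all add: polyring_def)
  have inv: "\<exists>q \<in> ?C. q + p = 0" if "p \<in> ?C" for p
    using uminus[OF that] by (intro bexI[of _ "- p"]) simp_all
  show ?thesis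
  proof (rule cringI)
    show "abelian_group (polyring n :: ((nat \<Rightarrow>\<^sub>0 nat) \<Rightarrow>\<^sub>0 'k) ring)"
      by (rule abelian_groupI; (unfold ring_simps)?)
        (intro add zero inv add.assoc add.commute add_0; assumption)+
    show "comm_monoid (polyring n :: ((nat \<Rightarrow>\<^sub>0 nat) \<Rightarrow>\<^sub>0 'k) ring)"
      by (rule comm_monoidI; (unfold ring_simps)?)
        (intro mult one mult.assoc mult.commute mult_1; assumption)+
  qed (unfold ring_simps, rule distrib_right)
qed

text \<open>
  Monomials are compared by the linear order of \<open>Poly_Mapping\<close>, which on exponent vectors
  is the lexicographic order with \<open>x\<^sub>1 > x\<^sub>2 > \<dots> > x\<^sub>n\<close>.
\<close>

lemma lex_less_iff:
  fixes m m' :: "nat \<Rightarrow>\<^sub>0 nat"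
  shows "m' < m \<longleftrightarrow>
    (\<exists>i. Poly_Mapping.lookup m' i < Poly_Mapping.lookup m i \<and>
         (\<forall>j<i. Poly_Mapping.lookup m' j = Poly_Mapping.lookup m j))"
  by transfer (simp add: less_fun_def)

definition xmon :: "nat set \<Rightarrow> (nat \<Rightarrow>\<^sub>0 nat)" where
  "xmon G = (\<Sum>i\<in>G. Poly_Mapping.single i 1)"

definition monomial :: "(nat \<Rightarrow>\<^sub>0 nat) \<Rightarrow> ((nat \<Rightarrow>\<^sub>0 nat) \<Rightarrow>\<^sub>0 'k::field)" where
  "monomial m = Poly_Mapping.single m 1"

definition sqfree_mons :: "nat \<Rightarrow> nat \<Rightarrow> (nat \<Rightarrow>\<^sub>0 nat) set" where
  "sqfree_mons n q =
     {m. Poly_Mapping.keys m \<subseteq> {1..n} \<and> (\<forall>i. Poly_Mapping.lookup m i \<le> 1) \<and>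
         (\<Sum>i\<in>{1..n}. Poly_Mapping.lookup m i) = q}"

definition full_sqfree_ideal :: "nat \<Rightarrow> nat \<Rightarrow> ((nat \<Rightarrow>\<^sub>0 nat) \<Rightarrow>\<^sub>0 'k::field) set" where
  "full_sqfree_ideal n q = Idl\<^bsub>polyring n\<^esub> (monomial ` sqfree_mons n q)"

definition final_lexsegment :: "nat \<Rightarrow> nat \<Rightarrow> (nat \<Rightarrow>\<^sub>0 nat) \<Rightarrow> (nat \<Rightarrow>\<^sub>0 nat) set" where
  "final_lexsegment n q u = {w \<in> sqfree_mons n q. u \<ge> w}"

definition final_lexsegment_ideal ::
    "nat \<Rightarrow> nat \<Rightarrow> (nat \<Rightarrow>\<^sub>0 nat) \<Rightarrow> ((nat \<Rightarrow>\<^sub>0 nat) \<Rightarrow>\<^sub>0 'k::field) set" where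
  "final_lexsegment_ideal n q u = Idl\<^bsub>polyring n\<^esub> (monomial ` final_lexsegment n q u)"

definition var_ideal :: "nat \<Rightarrow> nat set \<Rightarrow> ((nat \<Rightarrow>\<^sub>0 nat) \<Rightarrow>\<^sub>0 'k::field) set" where
  "var_ideal n G = Idl\<^bsub>polyring n\<^esub> ((\<lambda>i. monomial (Poly_Mapping.single i 1)) ` G)"

definition primary_ideal :: "'a set \<Rightarrow> ('a, 'b) ring_scheme \<Rightarrow> bool" where
  "primary_ideal Q R \<longleftrightarrow> ideal Q R \<and> Q \<noteq> carrier R \<and>
     (\<forall>a \<in> carrier R. \<forall>b \<in> carrier R. a \<otimes>\<^bsub>R\<^esub> b \<in> Q \<longrightarrow>
        a \<in> Q \<or> (\<exists>m::nat. m \<ge> 1 \<and> b [^]\<^bsub>R\<^esub> m \<in> Q))"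

definition radical :: "('a, 'b) ring_scheme \<Rightarrow> 'a set \<Rightarrow> 'a set" where
  "radical R I = {a \<in> carrier R. \<exists>m::nat. m \<ge> 1 \<and> a [^]\<^bsub>R\<^esub> m \<in> I}"

text \<open>The intersection of an empty family is the whole ring.\<close>

definition ring_INT :: "('a, 'b) ring_scheme \<Rightarrow> 'i set \<Rightarrow> ('i \<Rightarrow> 'a set) \<Rightarrow> 'a set" where
  "ring_INT R J Q = carrier R \<inter> (\<Inter>j\<in>J. Q j)"

definition minimal_primary_decomposition ::
    "('a, 'b) ring_scheme \<Rightarrow> 'a set \<Rightarrow> 'i set \<Rightarrow> ('i \<Rightarrow> 'a set) \<Rightarrow> bool" where
  "minimal_primary_decomposition R I J Q \<longleftrightarrow>
     finite J \<and> (\<forall>j\<in>J. primary_ideal (Q j) R) \<and>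
     I = ring_INT R J Q \<and>
     (\<forall>j\<in>J. \<not> ring_INT R (J - {j}) Q \<subseteq> Q j) \<and>
     inj_on (\<lambda>j. radical R (Q j)) J"

definition minimal_primes :: "('a, 'b) ring_scheme \<Rightarrow> 'a set \<Rightarrow> 'a set set" where
  "minimal_primes R I =
     {P. primeideal P R \<and> I \<subseteq> P \<and> \<not> (\<exists>P'. primeideal P' R \<and> I \<subseteq> P' \<and> P' \<subset> P)}"

end

theory Submission
  imports Defs
begin

text \<open>
  The ideal \<open>I\<close> is generated by squarefree monomials, that is, by the sets \<open>S\<close> of \<open>q\<close> elements
  with \<open>x\<^sub>S \<le> x\<^sub>U\<close>, where \<open>U = {1} \<union> F\<close>. Regard these sets as the edges of a hypergraph on
  \<open>{1..n}\<close>. The proof has an algebraic half, which holds for every squarefree monomial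
  ideal, and a combinatorial half, which is special to final lexsegments.

  Algebra. A prime ideal contains \<open>x\<^sub>S\<close> iff it contains some variable \<open>x\<^sub>j\<close> with \<open>j \<in> S\<close>. Hence a
  prime above \<open>I\<close> contains \<open>P\<^sub>G\<close> for the vertex cover \<open>G\<close> of the variables lying in it, and the minimal
  primes of \<open>I\<close> are the \<open>P\<^sub>G\<close> with \<open>G\<close> a minimal vertex cover
  (\<open>minimal_primes_edge_ideal\<close>). The intersection of these primes is \<open>I\<close>, because
  the variables absent from a monomial outside \<open>I\<close> form a cover
  (\<open>edge_ideal_eq_INT\<close>). It is irredundant, because the product of the variables outside a minimal
  cover \<open>G\<close> avoids \<open>P\<^sub>G\<close> and lies in \<open>P\<^sub>H\<close> for every other minimal cover \<open>H\<close>
  (\<open>minimal_primary_decomposition_edge_ideal\<close>).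

  Combinatorics (\<open>minimal_covers_final_edges\<close>). Let \<open>T\<close> be the complement of \<open>G\<close>. Then \<open>G\<close> is a minimal
  cover iff \<open>T\<close> contains no edge but \<open>T \<union> {g}\<close> contains one for each \<open>g \<in> G\<close>. Every set of \<open>q\<close>
  elements that avoids \<open>1\<close> is an edge, since \<open>1 \<in> U\<close>; so \<open>T\<close> has at most \<open>q\<close> elements, and it has
  at least \<open>q - 1\<close>.
  \<^item> If \<open>T\<close> has \<open>q\<close> elements, the condition is that \<open>T\<close> is not an edge, \<open>x\<^sub>T > x\<^sub>U\<close>. This forces
    \<open>1 \<in> T\<close>, and replacing \<open>1\<close> by \<open>g\<close> then yields an edge, so minimality is automatic. This is \<open>\<C>\<close>.
  \<^item> If \<open>T\<close> has \<open>q - 1\<close> elements, the condition is that all \<open>T \<union> {g}\<close> are edges. The largest of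
    them in the order is the one with \<open>g = Min G\<close>, so only \<open>x\<^sub>T x\<^sub>g \<le> x\<^sub>U\<close> for this \<open>g\<close> matters. For
    \<open>1 \<in> G\<close> the factor \<open>x\<^sub>1\<close> cancels and gives \<open>\<A>\<close>; for \<open>1 \<notin> G\<close> one gets \<open>\<B>\<close>.

  In all three cases complementation in \<open>{1..n}\<close> reverses the order and turns the condition on \<open>T\<close> into the one
  on \<open>G\<close>.
\<close>

section \<open>Monomial ideals and sets of exponents\<close>

text \<open>
  For an upward closed \<open>U\<close> this is the monomial ideal whose monomials are those satisfying \<open>U\<close>; for
  general \<open>U\<close> it is only a subspace. Both kinds are used: a polynomial is split into a part inside
  \<open>P\<^sub>G\<close> and a part none of whose monomials lies in \<open>P\<^sub>G\<close>.
\<close>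

definition monomial_span ::
    "nat \<Rightarrow> ((nat \<Rightarrow>\<^sub>0 nat) \<Rightarrow> bool) \<Rightarrow> ((nat \<Rightarrow>\<^sub>0 nat) \<Rightarrow>\<^sub>0 'k::field) set" where
  "monomial_span n U = {p \<in> carrier (polyring n). \<forall>m \<in> Poly_Mapping.keys p. U m}"

lemma polyring_simps [simp]:
  "x \<otimes>\<^bsub>polyring n\<^esub> y = x * y" "x \<oplus>\<^bsub>polyring n\<^esub> y = x + y"
  "\<one>\<^bsub>polyring n\<^esub> = 1" "\<zero>\<^bsub>polyring n\<^esub> = 0"
  by (simp_all add: polyring_def)

lemma ring_polyring: "ring (polyring n)"
  using cring_polyring cring.axioms(1) by blast

lemma in_carrier_polyring_iff:
  "p \<in> carrier (polyring n) \<longleftrightarrow> (\<forall>m \<in> Poly_Mapping.keys p. Poly_Mapping.keys m \<subseteq> {1..n})"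
  by (simp add: polyring_def)

lemma keys_add_nat:
  fixes a b :: "'a \<Rightarrow>\<^sub>0 nat"
  shows "Poly_Mapping.keys (a + b) = Poly_Mapping.keys a \<union> Poly_Mapping.keys b"
  by (auto simp: in_keys_iff lookup_add)

lemma keys_monomial [simp]: "Poly_Mapping.keys (monomial m :: _ \<Rightarrow>\<^sub>0 'k::field) = {m}"
  by (simp add: monomial_def)

lemma monomial_in_monomial_span_iff:
  "(monomial m :: _ \<Rightarrow>\<^sub>0 'k::field) \<in> monomial_span n U \<longleftrightarrow> Poly_Mapping.keys m \<subseteq> {1..n} \<and> U m"
  by (simp add: monomial_span_def in_carrier_polyring_iff)

lemma sum_single_lookup:
  fixes p :: "'a \<Rightarrow>\<^sub>0 'b::comm_monoid_add"
  shows "(\<Sum>m\<in>Poly_Mapping.keys p. Poly_Mapping.single m (Poly_Mapping.lookup p m)) = p"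
proof (rule poly_mapping_eqI)
  fix k
  have "(\<Sum>m\<in>Poly_Mapping.keys p. Poly_Mapping.lookup (Poly_Mapping.single m (Poly_Mapping.lookup p m)) k)
      = (\<Sum>m\<in>Poly_Mapping.keys p. if k = m then Poly_Mapping.lookup p m else 0)"
    by (intro sum.cong) (auto simp: lookup_single when_def)
  also have "\<dots> = Poly_Mapping.lookup p k"
    by (simp add: in_keys_iff)
  finally show "Poly_Mapping.lookup
      (\<Sum>m\<in>Poly_Mapping.keys p. Poly_Mapping.single m (Poly_Mapping.lookup p m)) k = Poly_Mapping.lookup p k"
    by (simp add: lookup_sum)
qed

lemma ideal_monomial_span:
  assumes up: "\<And>a b. U b \<Longrightarrow> U (a + b)"
  shows "ideal (monomial_span n U :: ((nat \<Rightarrow>\<^sub>0 nat) \<Rightarrow>\<^sub>0 'k::field) set) (polyring n)"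
proof -
  let ?R = "polyring n :: ((nat \<Rightarrow>\<^sub>0 nat) \<Rightarrow>\<^sub>0 'k) ring"
  let ?J = "monomial_span n U :: ((nat \<Rightarrow>\<^sub>0 nat) \<Rightarrow>\<^sub>0 'k) set"
  interpret cring ?R by (rule cring_polyring)
  have minus: "\<ominus>\<^bsub>?R\<^esub> a = - a" if "a \<in> carrier ?R" for a
  proof -
    have "- a \<in> carrier ?R" using that by (simp add: in_carrier_polyring_iff)
    then show ?thesis by (intro minus_equality) (use that in auto)
  qed
  have mult: "x * a \<in> ?J" if "a \<in> ?J" "x \<in> carrier ?R" for a x
  proof -
    have "x * a \<in> carrier ?R"
      using that m_closed[of x a] by (simp add: monomial_span_def)
    moreover have "U m" if m: "m \<in> Poly_Mapping.keys (x * a)" for m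
      using m keys_mult[of x a] up \<open>a \<in> ?J\<close> by (auto simp: monomial_span_def)
    ultimately show ?thesis by (simp add: monomial_span_def)
  qed
  show ?thesis
  proof (rule idealI)
    show "ring ?R" by (rule ring_polyring)
    show "subgroup ?J (add_monoid ?R)"
    proof (rule add.subgroupI)
      show "?J \<subseteq> carrier ?R" by (auto simp: monomial_span_def)
      have "0 \<in> ?J" by (simp add: monomial_span_def in_carrier_polyring_iff)
      then show "?J \<noteq> {}" by blast
      show "\<ominus>\<^bsub>?R\<^esub> a \<in> ?J" if "a \<in> ?J" for a
        using that minus[of a] by (auto simp: monomial_span_def in_carrier_polyring_iff)
      show "a \<oplus>\<^bsub>?R\<^esub> b \<in> ?J" if "a \<in> ?J" "b \<in> ?J" for a b
        using that Poly_Mapping.keys_add[of a b]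
        by (simp add: monomial_span_def in_carrier_polyring_iff) blast
    qed
  next
    fix a x assume "a \<in> ?J" "x \<in> carrier ?R"
    then show "x \<otimes>\<^bsub>?R\<^esub> a \<in> ?J" "a \<otimes>\<^bsub>?R\<^esub> x \<in> ?J"
      using mult[of a x] by (simp_all add: mult.commute)
  qed
qed

lemma ideal_mem_if_terms_mem:
  fixes J :: "((nat \<Rightarrow>\<^sub>0 nat) \<Rightarrow>\<^sub>0 'k::field) set"
  assumes J: "ideal J (polyring n)"
    and terms: "\<And>m. m \<in> Poly_Mapping.keys p \<Longrightarrow> Poly_Mapping.single m (Poly_Mapping.lookup p m) \<in> J"
  shows "p \<in> J"
proof -
  interpret ideal J "polyring n" by (rule J)
  have "(\<Sum>m\<in>A. Poly_Mapping.single m (Poly_Mapping.lookup p m)) \<in> J"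
    if "finite A" "A \<subseteq> Poly_Mapping.keys p" for A
    using that
  proof (induction A rule: finite_induct)
    case empty
    show ?case using additive_subgroup.zero_closed[OF additive_subgroup_axioms] by simp
  next
    case (insert m A)
    then show ?case
      using additive_subgroup.a_closed[OF additive_subgroup_axioms] terms by simp
  qed
  from this[OF finite_keys order_refl] show ?thesis by (simp only: sum_single_lookup)
qed

text \<open>
  A multiple of a sum of terms is again a sum of terms divisible by the same monomials, and conversely each
  term of a polynomial on the right is a multiple of one generator. Membership in a monomial ideal is
  thereby decided exponent by exponent, and the ideals \<open>I\<close> and \<open>P\<^sub>G\<close> reduce to conditions on supports.
\<close>

lemma Idl_monomials:
  assumes M: "\<And>a. a \<in> M \<Longrightarrow> Poly_Mapping.keys a \<subseteq> {1..n}"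
  shows "Idl\<^bsub>polyring n\<^esub> (monomial ` M) =
    (monomial_span n (\<lambda>m. \<exists>a\<in>M. \<exists>b. m = b + a) :: ((nat \<Rightarrow>\<^sub>0 nat) \<Rightarrow>\<^sub>0 'k::field) set)"
    (is "Idl\<^bsub>?R\<^esub> ?S = ?J")
proof
  interpret cring ?R by (rule cring_polyring)
  have S: "?S \<subseteq> carrier ?R" using M by (auto simp: in_carrier_polyring_iff)
  show "Idl\<^bsub>?R\<^esub> ?S \<subseteq> ?J"
  proof (rule genideal_minimal)
    show "ideal ?J ?R"
      by (rule ideal_monomial_span) (metis add.assoc)
    show "?S \<subseteq> ?J"
      using M by (auto simp: monomial_in_monomial_span_iff) (metis add_0)
  qed
  have idl: "ideal (Idl\<^bsub>?R\<^esub> ?S) ?R" by (rule genideal_ideal[OF S])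
  show "?J \<subseteq> Idl\<^bsub>?R\<^esub> ?S"
  proof
    fix p assume p: "p \<in> ?J"
    show "p \<in> Idl\<^bsub>?R\<^esub> ?S"
    proof (rule ideal_mem_if_terms_mem[OF idl])
      fix m assume m: "m \<in> Poly_Mapping.keys p"
      then obtain a b where ab: "a \<in> M" "m = b + a"
        using p by (auto simp: monomial_span_def)
      let ?c = "Poly_Mapping.single b (Poly_Mapping.lookup p m)"
      have "Poly_Mapping.keys m \<subseteq> {1..n}"
        using p m unfolding monomial_span_def in_carrier_polyring_iff by blast
      then have "Poly_Mapping.keys b \<subseteq> {1..n}" by (simp add: ab(2) keys_add_nat)
      then have "?c \<in> carrier ?R" by (simp add: in_carrier_polyring_iff)
      moreover have "monomial a \<in> Idl\<^bsub>?R\<^esub> ?S" using genideal_self[OF S] ab(1) by blast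
      ultimately have "?c * monomial a \<in> Idl\<^bsub>?R\<^esub> ?S"
        using ideal.I_l_closed[OF idl] by fastforce
      then show "Poly_Mapping.single m (Poly_Mapping.lookup p m) \<in> Idl\<^bsub>?R\<^esub> ?S"
        by (simp add: monomial_def mult_single ab(2))
    qed
  qed
qed

lemma lookup_xmon: "finite G \<Longrightarrow> Poly_Mapping.lookup (xmon G) j = (if j \<in> G then 1 else 0)"
  by (simp add: xmon_def lookup_sum lookup_single when_def)

lemma keys_xmon: "finite G \<Longrightarrow> Poly_Mapping.keys (xmon G) = G"
  by (auto simp: in_keys_iff lookup_xmon split: if_splits)

lemma xmon_divides_iff:
  assumes "finite S"
  shows "(\<exists>b. m = b + xmon S) \<longleftrightarrow> S \<subseteq> Poly_Mapping.keys m"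
proof
  assume "\<exists>b. m = b + xmon S"
  then show "S \<subseteq> Poly_Mapping.keys m"
    using assms by (auto simp: keys_add_nat keys_xmon)
next
  assume "S \<subseteq> Poly_Mapping.keys m"
  then have "m = (m - xmon S) + xmon S"
    using assms by (intro poly_mapping_eqI) (auto simp: lookup_add lookup_minus lookup_xmon in_keys_iff)
  then show "\<exists>b. m = b + xmon S" by blast
qed

lemma var_ideal_eq:
  assumes "G \<subseteq> {1..n}"
  shows "var_ideal n G = monomial_span n (\<lambda>m. Poly_Mapping.keys m \<inter> G \<noteq> {})"
proof -
  have single: "xmon {i} = Poly_Mapping.single i 1" for i by (simp add: xmon_def)
  have "var_ideal n G = Idl\<^bsub>polyring n\<^esub> (monomial ` (\<lambda>i. xmon {i}) ` G)"
    by (simp add: var_ideal_def single image_image)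
  also have "\<dots> = monomial_span n (\<lambda>m. \<exists>a\<in>(\<lambda>i. xmon {i}) ` G. \<exists>b. m = b + a)"
    using assms by (intro Idl_monomials) (auto simp: keys_xmon)
  also have "\<dots> = monomial_span n (\<lambda>m. Poly_Mapping.keys m \<inter> G \<noteq> {})"
    by (rule arg_cong[where f = "monomial_span n"]) (auto simp: xmon_divides_iff fun_eq_iff)
  finally show ?thesis .
qed

section \<open>Primes generated by variables\<close>

lemma variable_in_var_ideal_iff:
  assumes "G \<subseteq> {1..n}" "j \<in> {1..n}"
  shows "monomial (Poly_Mapping.single j 1) \<in> (var_ideal n G :: ((nat \<Rightarrow>\<^sub>0 nat) \<Rightarrow>\<^sub>0 'k::field) set)
    \<longleftrightarrow> j \<in> G"
  using assms by (auto simp: var_ideal_eq monomial_in_monomial_span_iff)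

lemma var_ideal_subset_iff:
  assumes "G \<subseteq> {1..n}" "H \<subseteq> {1..n}"
  shows "(var_ideal n G :: ((nat \<Rightarrow>\<^sub>0 nat) \<Rightarrow>\<^sub>0 'k::field) set) \<subseteq> var_ideal n H \<longleftrightarrow> G \<subseteq> H"
proof
  assume "(var_ideal n G :: ((nat \<Rightarrow>\<^sub>0 nat) \<Rightarrow>\<^sub>0 'k::field) set) \<subseteq> var_ideal n H"
  then show "G \<subseteq> H"
    using assms variable_in_var_ideal_iff[where 'k = 'k] by blast
next
  assume "G \<subseteq> H"
  then show "(var_ideal n G :: ((nat \<Rightarrow>\<^sub>0 nat) \<Rightarrow>\<^sub>0 'k::field) set) \<subseteq> var_ideal n H"
    unfolding var_ideal_eq[OF assms(1)] var_ideal_eq[OF assms(2)] monomial_span_def by blast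
qed

text \<open>
  Modulo \<open>P\<^sub>G\<close> every polynomial equals its part without the variables of \<open>G\<close>. A product of two such parts
  again involves no variable of \<open>G\<close>, so it lies in \<open>P\<^sub>G\<close> only if it is \<open>0\<close>; as polynomials
  have no zero divisors, one of the two parts is then \<open>0\<close>.
\<close>

lemma primeideal_var_ideal:
  assumes G: "G \<subseteq> {1..n}"
  shows "primeideal (var_ideal n G :: ((nat \<Rightarrow>\<^sub>0 nat) \<Rightarrow>\<^sub>0 'k::field) set) (polyring n)"
proof -
  let ?R = "polyring n :: ((nat \<Rightarrow>\<^sub>0 nat) \<Rightarrow>\<^sub>0 'k) ring"
  let ?U = "\<lambda>m :: nat \<Rightarrow>\<^sub>0 nat. Poly_Mapping.keys m \<inter> G \<noteq> {}"
  let ?P = "monomial_span n ?U :: ((nat \<Rightarrow>\<^sub>0 nat) \<Rightarrow>\<^sub>0 'k) set"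
  let ?Q = "monomial_span n (\<lambda>m. \<not> ?U m) :: ((nat \<Rightarrow>\<^sub>0 nat) \<Rightarrow>\<^sub>0 'k) set"
  have idl: "ideal ?P ?R"
    by (rule ideal_monomial_span) (auto simp: keys_add_nat)
  interpret ideal ?P ?R by (rule idl)
  have split: "\<exists>p1 p0. p = p0 + p1 \<and> p0 \<in> ?Q \<and> p1 \<in> ?P" if p: "p \<in> carrier ?R" for p
  proof -
    let ?part = "\<lambda>V. \<Sum>m\<in>{m \<in> Poly_Mapping.keys p. V m}. Poly_Mapping.single m (Poly_Mapping.lookup p m)"
    have "Poly_Mapping.keys (?part V) \<subseteq> {m \<in> Poly_Mapping.keys p. V m}" for V
      by (rule order_trans[OF Poly_Mapping.keys_sum]) auto
    then have mem: "?part V \<in> monomial_span n V" for V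
      using p by (fastforce simp: monomial_span_def in_carrier_polyring_iff)
    have "Poly_Mapping.keys p = {m \<in> Poly_Mapping.keys p. \<not> ?U m} \<union> {m \<in> Poly_Mapping.keys p. ?U m}"
      by blast
    then have "p = ?part (\<lambda>m. \<not> ?U m) + ?part ?U"
      by (subst sum.union_disjoint[symmetric]) (auto simp: sum_single_lookup simp flip: Collect_disj_eq)
    then show ?thesis using mem[of ?U] mem[of "\<lambda>m. \<not> ?U m"] by blast
  qed
  have "primeideal ?P ?R"
  proof (rule primeidealI)
    show "ideal ?P ?R" by (rule idl)
    show "cring ?R" by (rule cring_polyring)
    have "1 \<in> carrier ?R" "1 \<notin> ?P"
      by (simp_all add: monomial_span_def in_carrier_polyring_iff)
    then show "carrier ?R \<noteq> ?P" by blast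
    fix a b assume a: "a \<in> carrier ?R" and b: "b \<in> carrier ?R" and "a \<otimes>\<^bsub>?R\<^esub> b \<in> ?P"
    then have ab: "a * b \<in> ?P" by simp
    obtain a0 a1 where a': "a = a0 + a1" "a0 \<in> ?Q" "a1 \<in> ?P" using split[OF a] by blast
    obtain b0 b1 where b': "b = b0 + b1" "b0 \<in> ?Q" "b1 \<in> ?P" using split[OF b] by blast
    have a0: "a0 \<in> carrier ?R" using a'(2) unfolding monomial_span_def by blast
    have "a0 * b1 \<in> ?P" "a1 * b \<in> ?P"
      using I_l_closed[OF b'(3) a0] I_r_closed[OF a'(3) b] unfolding polyring_simps .
    from additive_subgroup.a_closed[OF additive_subgroup_axioms this]
    have r: "a0 * b1 + a1 * b \<in> ?P" unfolding polyring_simps .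
    have eq: "a0 * b0 = a * b - (a0 * b1 + a1 * b)"
      unfolding a'(1) b'(1) by (simp add: algebra_simps)
    have sub: "Poly_Mapping.keys (a0 * b0)
        \<subseteq> Poly_Mapping.keys (a * b) \<union> Poly_Mapping.keys (a0 * b1 + a1 * b)"
      unfolding eq by (rule keys_diff)
    have "Poly_Mapping.keys (a0 * b0) = {}"
    proof (rule equals0I)
      fix m assume m: "m \<in> Poly_Mapping.keys (a0 * b0)"
      then have "m \<in> Poly_Mapping.keys (a * b) \<or> m \<in> Poly_Mapping.keys (a0 * b1 + a1 * b)"
        using sub by blast
      then have "?U m" using ab r unfolding monomial_span_def by blast
      moreover obtain c d where cd: "m = c + d" "c \<in> Poly_Mapping.keys a0" "d \<in> Poly_Mapping.keys b0"
        using m keys_mult[of a0 b0] by blast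
      have "\<not> ?U c" "\<not> ?U d"
        using a'(2) b'(2) cd(2,3) unfolding monomial_span_def by blast+
      then have "\<not> ?U m" unfolding cd(1) keys_add_nat by blast
      ultimately show False by blast
    qed
    then have "a0 = 0 \<or> b0 = 0" by simp
    then show "a \<in> ?P \<or> b \<in> ?P" using a' b' by auto
  qed
  then show ?thesis by (simp add: var_ideal_eq[OF G])
qed

lemma (in primeideal) mem_if_pow_mem:
  assumes "a \<in> carrier R" "a [^] (m::nat) \<in> I"
  shows "a \<in> I"
  using assms(2)
proof (induction m)
  case 0
  then have "\<one> \<in> I" by simp
  then show ?case using I_notcarr one_imp_carrier by blast
next
  case (Suc m)
  then show ?case using I_prime[of "a [^] m" a] assms(1) by auto
qed

lemma primeideal_imp_primary:
  assumes "primeideal P R"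
  shows "primary_ideal P R"
proof -
  interpret primeideal P R by (rule assms)
  have "\<exists>m\<ge>1. b [^]\<^bsub>R\<^esub> (m::nat) \<in> P" if "b \<in> P" for b
    using that by (intro exI[of _ 1]) (simp add: a_Hcarr)
  then show ?thesis
    unfolding primary_ideal_def using I_prime I_notcarr is_ideal by blast
qed

lemma radical_primeideal:
  assumes "primeideal P R"
  shows "radical R P = P"
proof -
  interpret primeideal P R by (rule assms)
  have "\<exists>m\<ge>1. b [^]\<^bsub>R\<^esub> (m::nat) \<in> P" if "b \<in> P" for b
    using that by (intro exI[of _ 1]) (simp add: a_Hcarr)
  then show ?thesis
    unfolding radical_def using mem_if_pow_mem a_Hcarr by blast
qed

section \<open>Vertex covers and the decomposition of a squarefree monomial ideal\<close>

definition vertex_cover :: "'a set set \<Rightarrow> 'a set \<Rightarrow> bool" where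
  "vertex_cover E G \<longleftrightarrow> (\<forall>S\<in>E. S \<inter> G \<noteq> {})"

definition minimal_covers :: "'a set \<Rightarrow> 'a set set \<Rightarrow> 'a set set" where
  "minimal_covers V E = {G. G \<subseteq> V \<and> vertex_cover E G \<and> (\<forall>H. H \<subset> G \<longrightarrow> \<not> vertex_cover E H)}"

lemma vertex_cover_mono: "vertex_cover E H \<Longrightarrow> H \<subseteq> G \<Longrightarrow> vertex_cover E G"
  unfolding vertex_cover_def by blast

lemma minimal_cover_exists:
  assumes "finite V" "G \<subseteq> V" "vertex_cover E G"
  shows "\<exists>H\<in>minimal_covers V E. H \<subseteq> G"
proof -
  have "finite G" using assms finite_subset by blast
  from this assms(2,3) show ?thesis
  proof (induction G rule: finite_psubset_induct)
    case (psubset G)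
    show ?case
    proof (cases "\<exists>H. H \<subset> G \<and> vertex_cover E H")
      case True
      then show ?thesis using psubset by (meson order_trans psubset_imp_subset)
    next
      case False
      then show ?thesis using psubset.prems by (auto simp: minimal_covers_def)
    qed
  qed
qed

definition edge_ideal :: "nat \<Rightarrow> nat set set \<Rightarrow> ((nat \<Rightarrow>\<^sub>0 nat) \<Rightarrow>\<^sub>0 'k::field) set" where
  "edge_ideal n E = Idl\<^bsub>polyring n\<^esub> (monomial ` xmon ` E)"

lemma edge_ideal_eq:
  assumes "E \<subseteq> Pow {1..n}"
  shows "edge_ideal n E = monomial_span n (\<lambda>m. \<exists>S\<in>E. S \<subseteq> Poly_Mapping.keys m)"
proof -
  have sub: "S \<subseteq> {1..n}" if "S \<in> E" for S using that assms by blast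
  have fin: "finite S" if "S \<in> E" for S using sub[OF that] finite_subset by blast
  have "edge_ideal n E = monomial_span n (\<lambda>m. \<exists>a\<in>xmon ` E. \<exists>b. m = b + a)"
    unfolding edge_ideal_def
    by (intro Idl_monomials) (use sub fin in \<open>fastforce simp: keys_xmon\<close>)
  also have "\<dots> = monomial_span n (\<lambda>m. \<exists>S\<in>E. S \<subseteq> Poly_Mapping.keys m)"
    by (rule arg_cong[where f = "monomial_span n"]) (auto simp: xmon_divides_iff fin fun_eq_iff)
  finally show ?thesis .
qed

lemma edge_ideal_subset_var_ideal_iff:
  assumes E: "E \<subseteq> Pow {1..n}" and G: "G \<subseteq> {1..n}"
  shows "(edge_ideal n E :: ((nat \<Rightarrow>\<^sub>0 nat) \<Rightarrow>\<^sub>0 'k::field) set) \<subseteq> var_ideal n G \<longleftrightarrow> vertex_cover E G"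
proof
  assume sub: "(edge_ideal n E :: ((nat \<Rightarrow>\<^sub>0 nat) \<Rightarrow>\<^sub>0 'k::field) set) \<subseteq> var_ideal n G"
  show "vertex_cover E G"
    unfolding vertex_cover_def
  proof
    fix S assume S: "S \<in> E"
    then have keys: "Poly_Mapping.keys (xmon S) = S" "S \<subseteq> {1..n}"
      using E by (auto intro!: keys_xmon intro: finite_subset)
    then have "(monomial (xmon S) :: _ \<Rightarrow>\<^sub>0 'k) \<in> edge_ideal n E"
      using S by (auto simp: edge_ideal_eq[OF E] monomial_in_monomial_span_iff)
    then have "(monomial (xmon S) :: _ \<Rightarrow>\<^sub>0 'k) \<in> var_ideal n G" using sub by blast
    then show "S \<inter> G \<noteq> {}"
      by (simp add: var_ideal_eq[OF G] monomial_in_monomial_span_iff keys)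
  qed
next
  assume "vertex_cover E G"
  then show "(edge_ideal n E :: ((nat \<Rightarrow>\<^sub>0 nat) \<Rightarrow>\<^sub>0 'k::field) set) \<subseteq> var_ideal n G"
    unfolding edge_ideal_eq[OF E] var_ideal_eq[OF G] vertex_cover_def monomial_span_def by fast
qed

text \<open>
  If no edge is contained in the support of a monomial, the complement of the support is a cover; a
  minimal cover \<open>H\<close> inside it gives a prime \<open>P\<^sub>H\<close> that does not contain the monomial.
\<close>

lemma edge_ideal_eq_INT:
  assumes E: "E \<subseteq> Pow {1..n}"
  shows "edge_ideal n E = (ring_INT (polyring n) (minimal_covers {1..n} E) (var_ideal n)
    :: ((nat \<Rightarrow>\<^sub>0 nat) \<Rightarrow>\<^sub>0 'k::field) set)"
    (is "?I = ?INT")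
proof
  have "?I \<subseteq> carrier (polyring n)" by (auto simp: edge_ideal_eq[OF E] monomial_span_def)
  then show "?I \<subseteq> ?INT"
    using edge_ideal_subset_var_ideal_iff[OF E, where 'k = 'k]
    unfolding ring_INT_def minimal_covers_def by blast
  show "?INT \<subseteq> ?I"
  proof
    fix p assume p: "p \<in> ?INT"
    then have carr: "p \<in> carrier (polyring n)" by (simp add: ring_INT_def)
    have "\<exists>S\<in>E. S \<subseteq> Poly_Mapping.keys m" if m: "m \<in> Poly_Mapping.keys p" for m
    proof (rule ccontr)
      assume no_edge: "\<not> (\<exists>S\<in>E. S \<subseteq> Poly_Mapping.keys m)"
      then have "vertex_cover E ({1..n} - Poly_Mapping.keys m)"
        using E unfolding vertex_cover_def by blast
      then obtain H where H: "H \<in> minimal_covers {1..n} E" "H \<subseteq> {1..n} - Poly_Mapping.keys m"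
        using minimal_cover_exists[of "{1..n}"] by (metis Diff_subset finite_atLeastAtMost)
      then have "p \<in> var_ideal n H" using p by (simp add: ring_INT_def)
      moreover have "H \<subseteq> {1..n}" using H(2) by blast
      ultimately show False using H(2) m by (auto simp: var_ideal_eq monomial_span_def)
    qed
    then show "p \<in> ?I" using carr by (simp add: edge_ideal_eq[OF E] monomial_span_def)
  qed
qed

text \<open>
  The point is that every prime \<open>Q\<close> above the ideal contains one of the \<open>P\<^sub>H\<close>: the indices of the variables
  in \<open>Q\<close> form a cover, since a product of variables in \<open>Q\<close> has a factor in \<open>Q\<close>. Conversely, the
  \<open>P\<^sub>G\<close> of minimal covers are pairwise incomparable, so none of them is lost.
\<close>

lemma minimal_primes_edge_ideal:
  assumes E: "E \<subseteq> Pow {1..n}"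
  shows "minimal_primes (polyring n) (edge_ideal n E :: ((nat \<Rightarrow>\<^sub>0 nat) \<Rightarrow>\<^sub>0 'k::field) set)
    = var_ideal n ` minimal_covers {1..n} E"
proof -
  let ?R = "polyring n :: ((nat \<Rightarrow>\<^sub>0 nat) \<Rightarrow>\<^sub>0 'k) ring"
  let ?I = "edge_ideal n E :: ((nat \<Rightarrow>\<^sub>0 nat) \<Rightarrow>\<^sub>0 'k) set"
  let ?P = "var_ideal n :: nat set \<Rightarrow> ((nat \<Rightarrow>\<^sub>0 nat) \<Rightarrow>\<^sub>0 'k) set"
  have prime: "primeideal (?P G) ?R" if "G \<in> minimal_covers {1..n} E" for G
    using that primeideal_var_ideal[of G n] by (simp add: minimal_covers_def)
  have above: "?I \<subseteq> ?P G" if "G \<in> minimal_covers {1..n} E" for G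
    using that edge_ideal_subset_var_ideal_iff[OF E, of G, where 'k = 'k]
    by (simp add: minimal_covers_def)
  have below: "\<exists>H\<in>minimal_covers {1..n} E. ?P H \<subseteq> Q" if Q: "primeideal Q ?R" "?I \<subseteq> Q" for Q
  proof -
    interpret primeideal Q ?R by (rule Q(1))
    let ?x = "\<lambda>j. monomial (Poly_Mapping.single j 1) :: (nat \<Rightarrow>\<^sub>0 nat) \<Rightarrow>\<^sub>0 'k"
    define G where "G = {j \<in> {1..n}. ?x j \<in> Q}"
    have var: "?x j \<in> carrier ?R" if "j \<in> {1..n}" for j
      using that by (simp add: in_carrier_polyring_iff)
    have prod: "\<exists>j\<in>S. ?x j \<in> Q" if "finite S" "S \<subseteq> {1..n}" "monomial (xmon S) \<in> Q" for S
      using that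
    proof (induction S rule: finite_induct)
      case empty
      then have "\<one>\<^bsub>?R\<^esub> \<in> Q" by (simp add: xmon_def monomial_def)
      then show ?case using I_notcarr one_imp_carrier by blast
    next
      case (insert j S)
      have "monomial (xmon (insert j S)) = ?x j \<otimes>\<^bsub>?R\<^esub> monomial (xmon S)"
        using insert.hyps by (simp add: xmon_def monomial_def mult_single)
      moreover have "monomial (xmon S) \<in> carrier ?R"
        using insert by (simp add: in_carrier_polyring_iff keys_xmon)
      ultimately have "?x j \<in> Q \<or> monomial (xmon S) \<in> Q"
        using insert.prems var[of j] by (metis I_prime insert_subset)
      then show ?case using insert by auto
    qed
    have "vertex_cover E G"
      unfolding vertex_cover_def
    proof
      fix S assume S: "S \<in> E"
      then have fin: "S \<subseteq> {1..n}" "finite S" using E finite_subset[of S "{1..n}"] by auto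
      then have "(monomial (xmon S) :: _ \<Rightarrow>\<^sub>0 'k) \<in> ?I"
        using S by (auto simp: edge_ideal_eq[OF E] monomial_in_monomial_span_iff keys_xmon)
      then obtain j where "j \<in> S" "?x j \<in> Q" using prod[OF fin(2,1)] Q(2) by blast
      then show "S \<inter> G \<noteq> {}" using fin(1) unfolding G_def by blast
    qed
    moreover have "G \<subseteq> {1..n}" unfolding G_def by blast
    ultimately obtain H where H: "H \<in> minimal_covers {1..n} E" "H \<subseteq> G"
      using minimal_cover_exists[OF finite_atLeastAtMost] by blast
    have "?P H \<subseteq> Q"
      unfolding var_ideal_def
      by (rule genideal_minimal[OF is_ideal]) (use H(2) in \<open>auto simp: G_def\<close>)
    then show ?thesis using H(1) by blast
  qed
  have incomparable: "G = H" if "G \<in> minimal_covers {1..n} E" "H \<in> minimal_covers {1..n} E"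
    "?P H \<subseteq> ?P G" for G H
  proof -
    have sub: "G \<subseteq> {1..n}" "H \<subseteq> {1..n}" using that by (simp_all add: minimal_covers_def)
    have "H \<subseteq> G" using that(3) var_ideal_subset_iff[OF sub(2,1)] by blast
    then show ?thesis using that(1,2) unfolding minimal_covers_def by blast
  qed
  show ?thesis
  proof (intro equalityI subsetI)
    fix Q assume Q: "Q \<in> minimal_primes ?R ?I"
    then have "primeideal Q ?R" "?I \<subseteq> Q" unfolding minimal_primes_def by blast+
    then obtain H where H: "H \<in> minimal_covers {1..n} E" "?P H \<subseteq> Q" using below by blast
    then have "?P H = Q"
      using Q prime[OF H(1)] above[OF H(1)] unfolding minimal_primes_def by blast
    then show "Q \<in> ?P ` minimal_covers {1..n} E" using H(1) by blast
  next
    fix Q assume "Q \<in> ?P ` minimal_covers {1..n} E"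
    then obtain G where G: "G \<in> minimal_covers {1..n} E" "Q = ?P G" by blast
    have False if "primeideal P' ?R" "?I \<subseteq> P'" "P' \<subset> ?P G" for P'
      using below[OF that(1,2)] that(3) incomparable[OF G(1)] by blast
    then show "Q \<in> minimal_primes ?R ?I"
      using prime[OF G(1)] above[OF G(1)] G(2) by (auto simp: minimal_primes_def)
  qed
qed

text \<open>
  A prime is primary and its own radical, so distinct covers give distinct radicals, and only irredundance
  has to be argued. For a minimal cover \<open>G\<close> no other minimal cover is contained in \<open>G\<close>, and therefore
  the monomial on the complement of \<open>G\<close> separates \<open>P\<^sub>G\<close> from the other components.
\<close>

lemma minimal_primary_decomposition_edge_ideal:
  assumes E: "E \<subseteq> Pow {1..n}"
  shows "minimal_primary_decomposition (polyring n)
    (edge_ideal n E :: ((nat \<Rightarrow>\<^sub>0 nat) \<Rightarrow>\<^sub>0 'k::field) set) (minimal_covers {1..n} E) (var_ideal n)"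
proof -
  let ?R = "polyring n :: ((nat \<Rightarrow>\<^sub>0 nat) \<Rightarrow>\<^sub>0 'k) ring"
  let ?P = "var_ideal n :: nat set \<Rightarrow> ((nat \<Rightarrow>\<^sub>0 nat) \<Rightarrow>\<^sub>0 'k) set"
  let ?M = "minimal_covers {1..n} E"
  have sub: "G \<subseteq> {1..n}" if "G \<in> ?M" for G using that by (simp add: minimal_covers_def)
  have prime: "primeideal (?P G) ?R" if "G \<in> ?M" for G
    using primeideal_var_ideal[OF sub[OF that]] .
  have irredundant: "\<not> ring_INT ?R (?M - {G}) ?P \<subseteq> ?P G" if G: "G \<in> ?M" for G
  proof -
    let ?p = "monomial (xmon ({1..n} - G)) :: _ \<Rightarrow>\<^sub>0 'k"
    have "?p \<in> ?P H" if H: "H \<in> ?M - {G}" for H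
    proof -
      have "\<not> H \<subseteq> G" using G H by (auto simp: minimal_covers_def)
      then have "({1..n} - G) \<inter> H \<noteq> {}" using sub H by blast
      then show ?thesis
        using sub[of H] H by (simp add: var_ideal_eq monomial_in_monomial_span_iff keys_xmon)
    qed
    then have "?p \<in> ring_INT ?R (?M - {G}) ?P"
      by (simp add: ring_INT_def in_carrier_polyring_iff keys_xmon)
    moreover have "?p \<notin> ?P G"
      using sub[OF G] by (auto simp: var_ideal_eq monomial_in_monomial_span_iff keys_xmon)
    ultimately show ?thesis by blast
  qed
  have "?M \<subseteq> Pow {1..n}" using sub by blast
  then have "finite ?M" using finite_subset by blast
  moreover have "inj_on (\<lambda>G. radical ?R (?P G)) ?M"
  proof (rule inj_onI)
    fix G H assume GH: "G \<in> ?M" "H \<in> ?M" and eq: "radical ?R (?P G) = radical ?R (?P H)"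
    then have "?P G = ?P H" by (simp add: radical_primeideal[OF prime])
    then show "G = H"
      using var_ideal_subset_iff[OF sub sub, OF GH, where 'k = 'k]
        var_ideal_subset_iff[OF sub sub, OF GH(2,1), where 'k = 'k] by blast
  qed
  ultimately show ?thesis
    unfolding minimal_primary_decomposition_def
    using primeideal_imp_primary[OF prime] edge_ideal_eq_INT[OF E] irredundant by blast
qed

section \<open>The lexicographic order on squarefree monomials\<close>

text \<open>
  On sets the order looks at the least element \<open>i\<close> of the symmetric difference: the set that contains \<open>i\<close> is the
  larger one.
\<close>

lemma xmon_less_iff:
  assumes "finite G" "finite H"
  shows "xmon G < xmon H \<longleftrightarrow> (\<exists>i\<in>H - G. \<forall>j<i. j \<in> G \<longleftrightarrow> j \<in> H)"
proof -
  have "xmon G < xmon H \<longleftrightarrow> (\<exists>i. i \<in> H \<and> i \<notin> G \<and> (\<forall>j<i. j \<in> G \<longleftrightarrow> j \<in> H))"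
    unfolding lex_less_iff lookup_xmon[OF assms(1)] lookup_xmon[OF assms(2)]
    by (intro ex_cong1) auto
  then show ?thesis by blast
qed

lemma xmon_less_if_one:
  assumes "S \<subseteq> {1..n}" "T \<subseteq> {1..n}" "1 \<notin> S" "1 \<in> T"
  shows "xmon S < xmon T"
proof -
  have "finite S" "finite T" using assms(1,2) finite_subset by blast+
  moreover have "j \<notin> S" "j \<notin> T" if "j < 1" for j using that assms(1,2) by auto
  ultimately show ?thesis using assms(3,4) by (auto simp: xmon_less_iff)
qed

text \<open>
  Complementation keeps the symmetric difference and exchanges the two sets that can own its least element.
\<close>

lemma xmon_compl_less_iff:
  assumes "finite V" "S \<subseteq> V" "T \<subseteq> V"
  shows "xmon (V - S) < xmon (V - T) \<longleftrightarrow> xmon T < xmon S"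
proof -
  have fin: "finite S" "finite T" "finite (V - S)" "finite (V - T)"
    using assms finite_subset by blast+
  have "(V - T) - (V - S) = S - T" using assms by blast
  moreover have "(j \<in> V - S \<longleftrightarrow> j \<in> V - T) \<longleftrightarrow> (j \<in> T \<longleftrightarrow> j \<in> S)" for j
    using assms(2,3) by blast
  ultimately show ?thesis by (simp only: xmon_less_iff[OF fin(3,4)] xmon_less_iff[OF fin(2,1)])
qed

lemma xmon_compl_le_iff:
  assumes "finite V" "S \<subseteq> V" "T \<subseteq> V"
  shows "xmon (V - S) \<le> xmon (V - T) \<longleftrightarrow> xmon T \<le> xmon S"
  using xmon_compl_less_iff[OF assms(1,3,2)] by (simp flip: not_less)

lemma xmon_insert:
  assumes "finite S" "a \<notin> S"
  shows "xmon (insert a S) = Poly_Mapping.single a 1 + xmon S"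
  using assms by (simp add: xmon_def)

lemma xmon_insert_antimono:
  assumes "finite S" "a \<notin> S" "b \<notin> S" "a \<le> b"
  shows "xmon (insert b S) \<le> xmon (insert a S)"
proof (cases "a = b")
  case False
  then have "a < b" using assms(4) by simp
  then have "xmon (insert b S) < xmon (insert a S)"
    using assms(1-3) by (subst xmon_less_iff) (auto intro!: bexI[of _ a])
  then show ?thesis by simp
qed simp

lemma sqfree_mons_eq: "sqfree_mons n q = xmon ` {S. S \<subseteq> {1..n} \<and> card S = q}"
proof (intro equalityI subsetI)
  fix m assume m: "m \<in> sqfree_mons n q"
  let ?S = "Poly_Mapping.keys m"
  have lookup: "Poly_Mapping.lookup m j = (if j \<in> ?S then 1 else 0)" for j
  proof -
    have "Poly_Mapping.lookup m j \<le> 1" using m by (simp add: sqfree_mons_def)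
    then show ?thesis by (cases "Poly_Mapping.lookup m j") (auto simp: in_keys_iff)
  qed
  have "?S \<subseteq> {1..n}" using m by (simp add: sqfree_mons_def)
  moreover have "q = (\<Sum>j\<in>{1..n}. if j \<in> ?S then 1 else 0)"
    using m by (simp add: sqfree_mons_def flip: lookup)
  then have "q = card ({1..n} \<inter> ?S)" by (simp flip: sum.inter_restrict)
  ultimately have "?S \<subseteq> {1..n}" "card ?S = q" by (simp_all add: Int_absorb1)
  moreover have "m = xmon ?S"
    by (rule poly_mapping_eqI) (use lookup in \<open>simp add: lookup_xmon\<close>)
  ultimately show "m \<in> xmon ` {S. S \<subseteq> {1..n} \<and> card S = q}" by blast
next
  fix m assume "m \<in> xmon ` {S. S \<subseteq> {1..n} \<and> card S = q}"
  then obtain S where S: "m = xmon S" "S \<subseteq> {1..n}" "card S = q" by blast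
  then have "finite S" using finite_subset by blast
  then have "(\<Sum>j\<in>{1..n}. Poly_Mapping.lookup m j) = card ({1..n} \<inter> S)"
    by (simp add: S(1) lookup_xmon flip: sum.inter_restrict)
  then show "m \<in> sqfree_mons n q"
    using S \<open>finite S\<close> by (simp add: sqfree_mons_def keys_xmon lookup_xmon Int_absorb1)
qed

section \<open>Minimal covers of a final lexsegment\<close>

text \<open>
  The supports of the monomials in the final lexsegment of \<open>xmon W\<close>.
\<close>

definition final_edges :: "nat \<Rightarrow> nat \<Rightarrow> nat set \<Rightarrow> nat set set" where
  "final_edges n q W = {S. S \<subseteq> {1..n} \<and> card S = q \<and> xmon S \<le> xmon W}"

lemma final_lexsegment_ideal_eq:
  "final_lexsegment_ideal n q (xmon W) = edge_ideal n (final_edges n q W)"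
proof -
  have "final_lexsegment n q (xmon W) = xmon ` final_edges n q W"
    by (auto simp: final_lexsegment_def sqfree_mons_eq final_edges_def)
  then show ?thesis by (simp add: final_lexsegment_ideal_def edge_ideal_def)
qed

text \<open>
  Since covers are closed under enlargement, minimality needs testing only for the removal of a single
  element \<open>g\<close>, which adds \<open>g\<close> to the complement. Covers are described by their complements because there
  the defining inequality of the edges can be compared directly.
\<close>

lemma minimal_cover_iff_compl:
  assumes E: "E \<subseteq> Pow V" and G: "G \<subseteq> V"
  shows "G \<in> minimal_covers V E \<longleftrightarrow>
    (\<forall>S\<in>E. \<not> S \<subseteq> V - G) \<and> (\<forall>g\<in>G. \<exists>S\<in>E. S \<subseteq> insert g (V - G))"
proof -
  have cover: "vertex_cover E H \<longleftrightarrow> (\<forall>S\<in>E. \<not> S \<subseteq> V - H)" for H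
    using E unfolding vertex_cover_def by blast
  have "(\<forall>H. H \<subset> G \<longrightarrow> \<not> vertex_cover E H) \<longleftrightarrow> (\<forall>g\<in>G. \<not> vertex_cover E (G - {g}))"
  proof (intro iffI ballI allI impI)
    fix H assume min: "\<forall>g\<in>G. \<not> vertex_cover E (G - {g})" and "H \<subset> G"
    then obtain g where "g \<in> G" "H \<subseteq> G - {g}" by blast
    then show "\<not> vertex_cover E H" using min vertex_cover_mono by metis
  next
    fix g assume min: "\<forall>H. H \<subset> G \<longrightarrow> \<not> vertex_cover E H" and "g \<in> G"
    then have "G - {g} \<subset> G" by blast
    then show "\<not> vertex_cover E (G - {g})" using min by simp
  qed
  moreover have "V - (G - {g}) = insert g (V - G)" if "g \<in> G" for g using that G by blast
  ultimately show ?thesis using G by (simp add: minimal_covers_def cover)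
qed

text \<open>
  The proof distinguishes the size of the complement \<open>T\<close> of \<open>G\<close>. Complements larger than \<open>q\<close> contain an
  edge even after \<open>1\<close> is removed, and complements smaller than \<open>q - 1\<close> contain none even after an
  element is added; sizes \<open>q\<close> and \<open>q - 1\<close> give the family of \<open>card G = n - q\<close> and the two families of
  \<open>card G = n - q + 1\<close>.
\<close>

lemma minimal_covers_final_edges:
  fixes n q :: nat and F :: "nat set"
  defines "Fc \<equiv> {1..n} - F"
  assumes F: "F \<subseteq> {2..n}" and card_F: "card F + 1 = q" and q_le: "q \<le> n"
  shows "minimal_covers {1..n} (final_edges n q (insert 1 F)) =
      {G. G \<subseteq> {1..n} \<and> card G = n - q + 1 \<and> xmon Fc \<le> xmon G} \<union>
      {G. G \<subseteq> {1..n} - {1} \<and> card G = n - q + 1 \<and> xmon (Fc - {1}) \<le> xmon (G - {Min G})} \<union>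
      {G. G \<subseteq> {1..n} \<and> card G = n - q \<and> xmon G < xmon (Fc - {1})}"
    (is "?M = ?A \<union> ?B \<union> ?C")
proof -
  let ?V = "{1..n}"
  let ?E = "final_edges n q (insert 1 F)"
  let ?U = "insert 1 F"
  have E: "?E \<subseteq> Pow ?V" by (auto simp: final_edges_def)
  have U: "?U \<subseteq> ?V" using F q_le card_F by auto
  have F_V: "F \<subseteq> ?V" using F by auto
  have Fc1: "Fc - {1} = ?V - ?U" by (auto simp: Fc_def)
  have edgeI: "S \<in> ?E" if "S \<subseteq> ?V" "card S = q" "1 \<notin> S" for S
    using that xmon_less_if_one[OF that(1) U that(3)] by (auto simp: final_edges_def)
  have key: "G \<in> ?M \<longleftrightarrow> G \<in> ?A \<union> ?B \<union> ?C" if G: "G \<subseteq> ?V" for G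
  proof -
    let ?T = "?V - G"
    have fin: "finite G" "finite ?T" using G finite_subset by blast+
    have cards: "card G + card ?T = n"
      using card_Diff_subset[OF fin(1) G] card_mono[OF _ G] by simp
    have T_compl: "?V - ?T = G" using G by blast
    have mem_iff: "G \<in> ?A \<union> ?B \<union> ?C \<longleftrightarrow>
        card G = n - q + 1 \<and>
          (xmon Fc \<le> xmon G \<or> 1 \<notin> G \<and> xmon (Fc - {1}) \<le> xmon (G - {Min G})) \<or>
        card G = n - q \<and> xmon G < xmon (Fc - {1})"
      using G by blast
    note M_iff = minimal_cover_iff_compl[OF E G]
    have edge_eq: "S = X" if "S \<in> ?E" "S \<subseteq> X" "finite X" "card X = q" for S X
      using that card_subset_eq[of X S] by (simp add: final_edges_def)
    consider (large) "card ?T > q" | (eq) "card ?T = q" | (pred) "card ?T + 1 = q"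
      | (small) "card ?T + 1 < q" by linarith
    then show ?thesis
    proof cases
      case large
      then have "q \<le> card (?T - {1})" using diff_card_le_card_Diff[of "{1}" ?T] by simp
      then obtain S where S: "S \<subseteq> ?T - {1}" "card S = q" by (meson obtain_subset_with_card_n)
      then have "S \<in> ?E" by (intro edgeI) auto
      then have "G \<notin> ?M" using S(1) unfolding M_iff by blast
      moreover have "card G < n - q" using large cards by linarith
      ultimately show ?thesis unfolding mem_iff by simp
    next
      case eq
      have "G \<in> ?M \<longleftrightarrow> ?T \<notin> ?E"
      proof
        show "?T \<notin> ?E" if "G \<in> ?M" using that M_iff by blast
        assume T: "?T \<notin> ?E"
        then have 1: "1 \<in> ?T" using edgeI[of ?T] eq by blast
        have "\<exists>S\<in>?E. S \<subseteq> insert g ?T" if g: "g \<in> G" for g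
        proof -
          \<comment> \<open>exchanging \<open>1\<close> for \<open>g\<close> keeps the size and makes the set an edge\<close>
          have "card (?T - {1}) + 1 = q" using card_Suc_Diff1[OF fin(2) 1] eq by simp
          then have "card (insert g (?T - {1})) = q" using g fin(2) by simp
          then have "insert g (?T - {1}) \<in> ?E" using g G 1 by (intro edgeI) auto
          then show ?thesis by (rule bexI[rotated]) blast
        qed
        moreover have "\<not> S \<subseteq> ?T" if "S \<in> ?E" for S
        proof
          assume "S \<subseteq> ?T"
          then have "S = ?T" by (rule edge_eq[OF that _ fin(2) eq])
          then show False using that T by simp
        qed
        ultimately show "G \<in> ?M" unfolding M_iff by simp
      qed
      also have "\<dots> \<longleftrightarrow> xmon ?U < xmon ?T" using eq by (auto simp: final_edges_def)
      also have "\<dots> \<longleftrightarrow> xmon G < xmon (Fc - {1})"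
        using xmon_compl_less_iff[OF finite_atLeastAtMost Diff_subset U, of G]
        by (simp only: T_compl Fc1)
      finally have "G \<in> ?M \<longleftrightarrow> xmon G < xmon (Fc - {1})" .
      moreover have "card G = n - q" using eq cards by linarith
      ultimately show ?thesis unfolding mem_iff by simp
    next
      case pred
      have card_G: "card G = n - q + 1" using pred cards q_le by linarith
      have "G \<noteq> {}" using card_G by (metis card.empty add_is_0 one_neq_zero)
      then have Min_mem: "Min G \<in> G" using fin(1) by simp
      have insert_card: "card (insert g ?T) = q" if "g \<in> G" for g
        using that pred fin(2) by simp
      have "\<not> S \<subseteq> ?T" if "S \<in> ?E" for S
        using card_mono[OF fin(2), of S] that pred by (auto simp: final_edges_def)
      then have "G \<in> ?M \<longleftrightarrow> (\<forall>g\<in>G. \<exists>S\<in>?E. S \<subseteq> insert g ?T)" unfolding M_iff by simp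
      also have "\<dots> \<longleftrightarrow> (\<forall>g\<in>G. insert g ?T \<in> ?E)"
      proof (intro ball_cong refl iffI)
        fix g assume "g \<in> G" "\<exists>S\<in>?E. S \<subseteq> insert g ?T"
        then obtain S where S: "S \<in> ?E" "S \<subseteq> insert g ?T" by blast
        then have "S = insert g ?T"
          using fin(2) by (intro edge_eq insert_card[OF \<open>g \<in> G\<close>]) simp_all
        then show "insert g ?T \<in> ?E" using S(1) by simp
      qed (rule bexI, rule order_refl)
      also have "\<dots> \<longleftrightarrow> (\<forall>g\<in>G. xmon (insert g ?T) \<le> xmon ?U)"
      proof (rule ball_cong[OF refl])
        fix g assume g: "g \<in> G"
        then have "insert g ?T \<subseteq> ?V" using G by blast
        then show "insert g ?T \<in> ?E \<longleftrightarrow> xmon (insert g ?T) \<le> xmon ?U"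
          unfolding final_edges_def using insert_card[OF g] by blast
      qed
      \<comment> \<open>adding the least element of \<open>G\<close> gives the largest monomial\<close>
      also have "\<dots> \<longleftrightarrow> xmon (insert (Min G) ?T) \<le> xmon ?U"
      proof (intro iffI ballI)
        assume "\<forall>g\<in>G. xmon (insert g ?T) \<le> xmon ?U"
        then show "xmon (insert (Min G) ?T) \<le> xmon ?U" using Min_mem by (rule bspec)
      next
        fix g assume le: "xmon (insert (Min G) ?T) \<le> xmon ?U" and g: "g \<in> G"
        then have "xmon (insert g ?T) \<le> xmon (insert (Min G) ?T)"
          using Min_mem fin by (intro xmon_insert_antimono) simp_all
        then show "xmon (insert g ?T) \<le> xmon ?U" using le by (rule order_trans)
      qed
      finally have M_iff': "G \<in> ?M \<longleftrightarrow> xmon (insert (Min G) ?T) \<le> xmon ?U" .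
      show ?thesis
      proof (cases "1 \<in> G")
        case True
        have Min: "Min G = 1" using True G fin(1) by (intro Min_eqI) auto
        have "1 \<notin> F" using F by auto
        then have "xmon ?U = Poly_Mapping.single 1 1 + xmon F"
          using finite_subset[OF F] by (intro xmon_insert) simp_all
        moreover have "xmon (insert 1 ?T) = Poly_Mapping.single 1 1 + xmon ?T"
          using True fin(2) by (intro xmon_insert) simp_all
        ultimately have "G \<in> ?M \<longleftrightarrow> xmon ?T \<le> xmon F"
          unfolding M_iff' Min by (simp only: add_le_cancel_left)
        also have "\<dots> \<longleftrightarrow> xmon Fc \<le> xmon G"
          using xmon_compl_le_iff[OF finite_atLeastAtMost F_V Diff_subset, of G]
          by (simp only: T_compl Fc_def)
        finally have "G \<in> ?M \<longleftrightarrow> xmon Fc \<le> xmon G" .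
        then show ?thesis unfolding mem_iff using True card_G by simp
      next
        case False
        have compl: "?V - insert (Min G) ?T = G - {Min G}" using G by blast
        have "insert (Min G) ?T \<subseteq> ?V" using Min_mem G by blast
        from xmon_compl_le_iff[OF finite_atLeastAtMost U this]
        have "G \<in> ?M \<longleftrightarrow> xmon (Fc - {1}) \<le> xmon (G - {Min G})"
          by (simp only: M_iff' Fc1 compl)
        \<comment> \<open>a set without \<open>1\<close> cannot satisfy the inequality of the first family\<close>
        moreover have "xmon G < xmon Fc"
        proof (rule xmon_less_if_one[OF G _ False])
          show "Fc \<subseteq> {1..n}" unfolding Fc_def by blast
          show "1 \<in> Fc" using F U by (auto simp: Fc_def)
        qed
        then have "\<not> xmon Fc \<le> xmon G" by simp
        ultimately show ?thesis unfolding mem_iff using False card_G by simp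
      qed
    next
      case small
      have card_G: "n - q + 1 < card G" using small cards q_le by linarith
      then have "G \<noteq> {}" by auto
      then obtain g where g: "g \<in> G" by blast
      have "card S < q" if "S \<subseteq> insert g ?T" for S
        using card_mono[OF _ that] fin(2) small g by auto
      moreover have "card S = q" if "S \<in> ?E" for S using that by (simp add: final_edges_def)
      ultimately have "\<not> (\<exists>S\<in>?E. S \<subseteq> insert g ?T)" by (metis less_irrefl)
      then have "G \<notin> ?M" using M_iff g by metis
      then show ?thesis unfolding mem_iff using card_G by simp
    qed
  qed
  show ?thesis
  proof (intro equalityI subsetI)
    fix G assume M: "G \<in> ?M"
    then have "G \<subseteq> ?V" by (simp add: minimal_covers_def)
    from key[OF this] M show "G \<in> ?A \<union> ?B \<union> ?C" by (rule iffD1)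
  next
    fix G assume R: "G \<in> ?A \<union> ?B \<union> ?C"
    then have "G \<subseteq> ?V" by (elim UnE CollectE conjE) (assumption | rule order_trans[OF _ Diff_subset])+
    from key[OF this] R show "G \<in> ?M" by (rule iffD2)
  qed
qed

theorem theorem2:
  fixes n q :: nat and i :: "nat \<Rightarrow> nat" and u :: "nat \<Rightarrow>\<^sub>0 nat"
    and F Fc :: "nat set" and \<A> \<B> \<C> :: "nat set set"
    and I :: "((nat \<Rightarrow>\<^sub>0 nat) \<Rightarrow>\<^sub>0 'k::field) set"
  assumes "q \<ge> 2"
    and "strict_mono_on {2..q} i" and "2 \<le> i 2" and "i q \<le> n"
    and "u = Poly_Mapping.single 1 1 + (\<Sum>j\<in>{2..q}. Poly_Mapping.single (i j) 1)"
    and "I = final_lexsegment_ideal n q u"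
    and "I \<noteq> full_sqfree_ideal n q"
    and "F = i ` {2..q}" and "Fc = {1..n} - F"
    and "\<A> = {G. G \<subseteq> {1..n} \<and> card G = n - q + 1 \<and> xmon G \<ge> xmon Fc}"
    and "\<B> = {G. G \<subseteq> {1..n} - {1} \<and> card G = n - q + 1 \<and>
                xmon (G - {Min G}) \<ge> xmon (Fc - {1})}"
    and "\<C> = {G. G \<subseteq> {1..n} \<and> card G = n - q \<and> xmon (Fc - {1}) > xmon G}"
  shows "I = ring_INT (polyring n) \<A> (var_ideal n) \<inter>
             ring_INT (polyring n) \<B> (var_ideal n) \<inter>
             ring_INT (polyring n) \<C> (var_ideal n) \<and>
    \<A> \<inter> \<B> = {} \<and> \<A> \<inter> \<C> = {} \<and> \<B> \<inter> \<C> = {} \<and>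
    minimal_primary_decomposition (polyring n) I (\<A> \<union> \<B> \<union> \<C>) (var_ideal n) \<and>
    var_ideal n ` (\<A> \<union> \<B> \<union> \<C>) = minimal_primes (polyring n) I"
proof -
  let ?E = "final_edges n q (insert 1 F)"
  have inj: "inj_on i {2..q}" using assms(2) by (rule strict_mono_on_imp_inj_on)
  have mono: "i j \<le> i k" if "j \<in> {2..q}" "k \<in> {2..q}" "j \<le> k" for j k
    using strict_mono_on_leD[OF assms(2)] that by blast
  have "2 \<le> i j \<and> i j \<le> n" if "j \<in> {2..q}" for j
    using mono[of 2 j] mono[of j q] that assms(1,3,4) by auto
  then have F: "F \<subseteq> {2..n}" unfolding assms(8) by auto
  have card_F: "card F + 1 = q"
    using assms(1) by (simp add: assms(8) card_image[OF inj])
  have "card F \<le> card {2..n}" using F by (intro card_mono) auto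
  then have q_le: "q \<le> n" using card_F assms(1) by simp
  have "xmon F = (\<Sum>j\<in>{2..q}. Poly_Mapping.single (i j) 1)"
    by (simp add: xmon_def assms(8) sum.reindex[OF inj])
  then have "u = xmon (insert 1 F)"
    using F finite_subset[OF F] by (subst xmon_insert) (auto simp: assms(5))
  then have I: "I = edge_ideal n ?E"
    by (simp add: assms(6) final_lexsegment_ideal_eq)
  have E: "?E \<subseteq> Pow {1..n}" by (auto simp: final_edges_def)
  have M: "minimal_covers {1..n} ?E = \<A> \<union> \<B> \<union> \<C>"
    unfolding assms(9-12) by (rule minimal_covers_final_edges[OF F card_F q_le])
  have "1 \<in> {1..n}" "1 \<notin> F" using F q_le assms(1) by auto
  then have "1 \<in> Fc" unfolding assms(9) by (rule DiffI)
  have "xmon G < xmon Fc" if "G \<in> \<B>" for G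
  proof (rule xmon_less_if_one)
    show "G \<subseteq> {1..n}" "1 \<notin> G" using that unfolding assms(11) by blast+
    show "Fc \<subseteq> {1..n}" unfolding assms(9) by blast
  qed fact
  then have "\<A> \<inter> \<B> = {}" unfolding assms(10) using leD by blast
  moreover have "\<A> \<inter> \<C> = {}" "\<B> \<inter> \<C> = {}" by (auto simp: assms(10-12))
  moreover have "I = ring_INT (polyring n) \<A> (var_ideal n) \<inter>
      ring_INT (polyring n) \<B> (var_ideal n) \<inter> ring_INT (polyring n) \<C> (var_ideal n)"
    unfolding I edge_ideal_eq_INT[OF E] M by (auto simp: ring_INT_def)
  ultimately show ?thesis
    using minimal_primary_decomposition_edge_ideal[OF E, where 'k = 'k]
      minimal_primes_edge_ideal[OF E, where 'k = 'k]
    unfolding I M by simp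
qed

end
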